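(* Let $\{a_n\}_{n\ge0}$ be non-negative reals with $a_0=1$ and $\lim_{n\to\infty}\frac{\log a_n}{n}=-\infty$, and let $r\ge1$. Let $N(r)=\{0,j_1,\dots,j_{n-1}\}$, where $n=n(r)=\#N(r)$. Let $z_1,\dots,z_n$ be points on the circle $\{|z|=r\}$ such that the $n\times n$ generalized Vandermonde matrix $$A=\begin{pmatrix}1&z_1^{j_1}&\cdots&z_1^{j_{n-1}}\\ \vdots&\vdots&&\vdots\\ 1&z_n^{j_1}&\cdots&z_n^{j_{n-1}}\end{pmatrix}$$ satisfies $|\det A|\ge r^{\sum_{k=1}^{n-1}j_k}$. Let $\Sigma$ be the $n\times n$ matrix with entries $$\Sigma_{ij}=\sum_{k=0}^\infty a_k^2(z_i\overline{z_j})^k .$$ Then $\log(\det\Sigma)\ge S(r)$.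
   Context: Convention $\log0=-\infty$. $N(r)=\{n\ge0: a_nr^n\ge1\}$, a finite set which contains $0$ because $a_0=1$. $S(r)=2\sum_{n\ge0}\log^+(a_nr^n)=2\sum_{n\in N(r)}\log(a_nr^n)$. The matrix $\Sigma$ is the covariance matrix $\mathbb{E}\big(f(z_i)\overline{f(z_j)}\big)$ of the Gaussian vector $(f(z_1),\dots,f(z_n))$, where $f(z)=\sum_{k\ge0}\xi_ka_kz^k$ with $\xi_k$ i.i.d. standard complex Gaussians. A choice of points $z_1,\dots,z_n$ with the stated lower bound on $|\det A|$ always exists. *)

theory Defs
  imports "HOL-Library.Extended_Real" "Jordan_Normal_Form.Determinant"
begin

(* Logarithm with the convention log 0 = -infinity (note that ln 0 = 0 for type real);
   only used for non-negative arguments. *)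
definition log0 :: "real \<Rightarrow> ereal" where
  "log0 x = (if x = 0 then -\<infinity> else ereal (ln x))"

definition log_plus :: "real \<Rightarrow> real" where
  "log_plus x = real_of_ereal (max 0 (log0 x))"

definition N_set :: "(nat \<Rightarrow> real) \<Rightarrow> real \<Rightarrow> nat set" where
  "N_set a r = {n. a n * r ^ n \<ge> 1}"

definition S_fun :: "(nat \<Rightarrow> real) \<Rightarrow> real \<Rightarrow> real" where
  "S_fun a r = 2 * (\<Sum>n. log_plus (a n * r ^ n))"

(* Points and exponents are indexed from 0: row i belongs to z i, column k to the exponent j k,
   so that j 0 = 0 yields the first column of ones. *)
definition gen_vandermonde :: "nat \<Rightarrow> (nat \<Rightarrow> complex) \<Rightarrow> (nat \<Rightarrow> nat) \<Rightarrow> complex mat" where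
  "gen_vandermonde n z j = mat n n (\<lambda>(i, k). z i ^ j k)"

(* Covariance matrix E (f (z i) * cnj (f (z l))) of the Gaussian Taylor series
   f(z) = (\<Sum>k. \<xi> k * a k * z ^ k) with i.i.d. standard complex Gaussians \<xi> k. *)
definition Sigma_mat :: "(nat \<Rightarrow> real) \<Rightarrow> nat \<Rightarrow> (nat \<Rightarrow> complex) \<Rightarrow> complex mat" where
  "Sigma_mat a n z =
     mat n n (\<lambda>(i, l). \<Sum>k. complex_of_real ((a k)\<^sup>2) * (z i * cnj (z l)) ^ k)"

end

theory Submission
  imports Defs
begin

text \<open>The covariance matrix is an infinite sum of positive semidefinite rank-one matrices
  \<open>a\<^sub>k\<^sup>2 v\<^sub>k v\<^sub>k\<^sup>*\<close> with \<open>v\<^sub>k = (z\<^sub>1\<^sup>k, \<dots>, z\<^sub>n\<^sup>k)\<close>. Keeping only the \<open>n\<close> terms with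
  \<open>k \<in> N(r)\<close> gives the matrix \<open>A D A\<^sup>*\<close>, where \<open>A\<close> is the generalized Vandermonde matrix
  and \<open>D\<close> is diagonal with entries \<open>a\<^sub>k\<^sup>2\<close>. Its determinant is
  \<open>\<bar>det A\<bar>\<^sup>2 \<Prod> a\<^sub>k\<^sup>2 \<ge> \<Prod> (a\<^sub>k r\<^sup>k)\<^sup>2 = exp S(r)\<close>
  (\<open>det_weighted_gram_reindex\<close>, \<open>exp_S_fun\<close>).

  Adding the other terms can only increase the determinant. If \<open>P\<close> is positive definite and
  \<open>v = P w\<close>, then the rank-one determinant formula \<open>det_one_plus_rank_one\<close> gives
  \<open>det (P + v v\<^sup>*) = det P \<cdot> (1 + v\<^sup>* w) = det P \<cdot> (1 + w\<^sup>* P w) \<ge> det P\<close>;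
  this is \<open>det_weighted_gram_insert\<close>.
  Finitely many terms are covered by induction (\<open>det_weighted_gram_mono\<close>), all of them by
  continuity of the determinant, since the decay of \<open>a\<^sub>k\<close> makes the series of every entry
  converge.

  Inequalities between complex numbers such as \<open>0 < det P\<close> include the
  claim that their difference is real, so the order on the complex numbers carries the reality of
  the determinants through the argument.\<close>

section \<open>Two facts about determinants\<close>

text \<open>The block matrix with rows \<open>(1, w)\<close> and \<open>(-u\<^sup>T, 1)\<close> can be made block triangular by
  clearing its lower left corner with a column operation or with a row operation. The two resulting
  determinants are the two sides.\<close>

lemma det_one_plus_rank_one:
  fixes u w :: "nat \<Rightarrow> 'a :: idom"
  shows "det (mat n n (\<lambda>(i, l). (if i = l then 1 else 0) + w i * u l)) = 1 + (\<Sum>i<n. u i * w i)"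
proof -
  define W where "W = mat n 1 (\<lambda>(i, l). w i)"
  define U where "U = mat 1 n (\<lambda>(i, l). u l)"
  have W: "W \<in> carrier_mat n 1" and U: "U \<in> carrier_mat 1 n"
    by (auto simp: W_def U_def)
  let ?M = "four_block_mat (1\<^sub>m n) W (- U) (1\<^sub>m 1)"
  let ?L = "four_block_mat (1\<^sub>m n) (0\<^sub>m n 1) U (1\<^sub>m 1)"
  have M: "?M \<in> carrier_mat (n + 1) (n + 1)" and L: "?L \<in> carrier_mat (n + 1) (n + 1)"
    using W U by auto
  have det_L: "det ?L = 1"
    by (subst det_four_block_mat_upper_right_zero[OF _ refl U]) auto
  have "?M * ?L = four_block_mat (1\<^sub>m n + W * U) W (0\<^sub>m 1 n) (1\<^sub>m 1)"
    by (subst mult_four_block_mat[of _ n n _ 1 _ 1 _ _ n _ 1], insert W U,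
        auto intro!: cong_four_block_mat)
  hence "det ?M = det (1\<^sub>m n + W * U)"
    using det_mult[OF M L] det_L W U
    by (simp add: det_four_block_mat_lower_left_zero[of _ n W 1])
  moreover have "?L * ?M = four_block_mat (1\<^sub>m n) W (0\<^sub>m 1 n) (U * W + 1\<^sub>m 1)"
    by (subst mult_four_block_mat[of _ n n _ 1 _ 1 _ _ n _ 1], insert W U,
        auto intro!: cong_four_block_mat)
  hence "det ?M = det (U * W + 1\<^sub>m 1)"
    using det_mult[OF L M] det_L W U
    by (simp add: det_four_block_mat_lower_left_zero[of _ n W 1])
  moreover have "det (U * W + 1\<^sub>m 1) = 1 + (\<Sum>i<n. u i * w i)"
    by (subst det_single) (auto simp: U_def W_def scalar_prod_def lessThan_atLeast0)
  moreover have "1\<^sub>m n + W * U = mat n n (\<lambda>(i, l). (if i = l then 1 else 0) + w i * u l)"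
    by (rule eq_matI) (auto simp: U_def W_def scalar_prod_def)
  ultimately show ?thesis by simp
qed

lemma tendsto_det:
  fixes A :: "'b \<Rightarrow> complex mat"
  assumes "\<And>m. A m \<in> carrier_mat n n" and "B \<in> carrier_mat n n"
    and "\<And>i l. i < n \<Longrightarrow> l < n \<Longrightarrow> ((\<lambda>m. A m $$ (i, l)) \<longlongrightarrow> B $$ (i, l)) F"
  shows "((\<lambda>m. det (A m)) \<longlongrightarrow> det B) F"
  unfolding det_def'[OF assms(1)] det_def'[OF assms(2)]
  by (intro tendsto_sum tendsto_mult tendsto_const tendsto_prod assms(3))
     (auto simp: permutes_in_image)

section \<open>Determinants of weighted Gram matrices\<close>

text \<open>For \<open>c \<ge> 0\<close> this is the positive semidefinite matrix
  \<open>\<Sum>\<^bsub>k\<in>K\<^esub> c\<^sub>k v\<^sub>k v\<^sub>k\<^sup>*\<close>. The index set is a parameter so that adding a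
  rank-one term is inserting an index.\<close>

definition weighted_gram ::
  "nat \<Rightarrow> 'k set \<Rightarrow> ('k \<Rightarrow> real) \<Rightarrow> ('k \<Rightarrow> nat \<Rightarrow> complex) \<Rightarrow> complex mat" where
  "weighted_gram n K c v = mat n n (\<lambda>(i, l). \<Sum>k\<in>K. of_real (c k) * (v k i * cnj (v k l)))"

lemma weighted_gram_carrier [simp]: "weighted_gram n K c v \<in> carrier_mat n n"
  by (simp add: weighted_gram_def)

lemma det_nonzero_solvable:
  fixes P :: "'a :: field mat"
  assumes P: "P \<in> carrier_mat n n" and "det P \<noteq> 0"
  shows "\<exists>w. \<forall>i<n. b i = (\<Sum>m<n. P $$ (i, m) * w m)"
proof -
  obtain Q where Q: "Q \<in> carrier_mat n n" and PQ: "P * Q = 1\<^sub>m n"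
    using det_non_zero_imp_unit[OF assms, of "()"] by (auto simp: Units_def ring_mat_def)
  have "P *\<^sub>v (Q *\<^sub>v vec n b) = (P * Q) *\<^sub>v vec n b"
    using P Q by (simp add: assoc_mult_mat_vec[of _ n n _ n])
  hence eq: "P *\<^sub>v (Q *\<^sub>v vec n b) = vec n b" by (simp add: PQ)
  have "b i = (\<Sum>m<n. P $$ (i, m) * (Q *\<^sub>v vec n b) $ m)" if "i < n" for i
    using arg_cong[OF eq, of "\<lambda>x. x $ i"] that P Q
    by (simp add: scalar_prod_def lessThan_atLeast0)
  thus ?thesis by blast
qed

text \<open>When \<open>P w = b\<close> for the Gram matrix \<open>P\<close>, the number \<open>b\<^sup>* w\<close> equals \<open>w\<^sup>* P w\<close>,
  which is the sum of the squared moduli \<open>\<bar>v\<^sub>k\<^sup>* w\<bar>\<^sup>2\<close> with the weights \<open>c\<^sub>k\<close>.\<close>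

lemma weighted_gram_solution_nonneg:
  assumes c: "\<And>k. k \<in> K \<Longrightarrow> 0 \<le> c k"
    and w: "\<And>i. i < n \<Longrightarrow> b i = (\<Sum>m<n. weighted_gram n K c v $$ (i, m) * w m)"
  shows "0 \<le> (\<Sum>l<n. cnj (b l) * w l)"
proof -
  have b: "b l = (\<Sum>k\<in>K. of_real (c k) * (v k l * (\<Sum>m<n. cnj (v k m) * w m)))"
    if "l < n" for l
  proof -
    have "b l = (\<Sum>m<n. \<Sum>k\<in>K. of_real (c k) * (v k l * cnj (v k m)) * w m)"
      using w[OF that] that by (simp add: weighted_gram_def sum_distrib_right)
    also have "\<dots> = (\<Sum>k\<in>K. \<Sum>m<n. of_real (c k) * (v k l * cnj (v k m)) * w m)"
      by (rule sum.swap)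
    finally show ?thesis by (simp add: sum_distrib_left mult_ac)
  qed
  have "(\<Sum>l<n. cnj (b l) * w l) =
      (\<Sum>l<n. \<Sum>k\<in>K. of_real (c k) * (cnj (v k l) * w l * cnj (\<Sum>m<n. cnj (v k m) * w m)))"
    by (rule sum.cong) (simp_all add: b sum_distrib_right sum_distrib_left mult_ac)
  also have "\<dots> =
      (\<Sum>k\<in>K. \<Sum>l<n. of_real (c k) * (cnj (v k l) * w l * cnj (\<Sum>m<n. cnj (v k m) * w m)))"
    by (rule sum.swap)
  also have "\<dots> = (\<Sum>k\<in>K. of_real (c k * (cmod (\<Sum>m<n. cnj (v k m) * w m))\<^sup>2))"
    by (intro sum.cong refl)
       (simp only: sum_distrib_left[symmetric] sum_distrib_right[symmetric]
         complex_norm_square of_real_mult)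
  also have "0 \<le> \<dots>"
    by (intro sum_nonneg) (simp add: c less_eq_complex_def)
  finally show ?thesis .
qed

text \<open>Solving \<open>P w = v\<^sub>q\<close> lets \<open>P\<close> be factored out of the enlarged matrix. The determinant grows
  by the factor \<open>1 + c\<^sub>q v\<^sub>q\<^sup>* w \<ge> 1\<close>.\<close>

lemma det_weighted_gram_insert:
  assumes "finite K" and "q \<notin> K" and c: "\<And>k. k \<in> insert q K \<Longrightarrow> 0 \<le> c k"
    and pos: "0 < det (weighted_gram n K c v)"
  shows "det (weighted_gram n K c v) \<le> det (weighted_gram n (insert q K) c v)"
proof -
  let ?P = "weighted_gram n K c v"
  have "det ?P \<noteq> 0" using pos by auto
  then obtain w where w: "\<And>i. i < n \<Longrightarrow> v q i = (\<Sum>m<n. ?P $$ (i, m) * w m)"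
    using det_nonzero_solvable[of ?P n "v q"] by auto
  \<comment> \<open>\<open>P + c\<^sub>q v\<^sub>q v\<^sub>q\<^sup>* = P (1 + w (c\<^sub>q v\<^sub>q\<^sup>*))\<close>\<close>
  define R where
    "R = mat n n (\<lambda>(m, l). (if m = l then 1 else 0) + w m * (of_real (c q) * cnj (v q l)))"
  have R: "R \<in> carrier_mat n n" by (simp add: R_def)
  have "weighted_gram n (insert q K) c v = ?P * R"
  proof (rule eq_matI)
    fix i l assume "i < dim_row (?P * R)" and "l < dim_col (?P * R)"
    hence i: "i < n" and l: "l < n"
      using R by (auto simp: weighted_gram_def)
    have "(?P * R) $$ (i, l) = (\<Sum>m<n. ?P $$ (i, m) * R $$ (m, l))"
      using i l R by (simp add: scalar_prod_def lessThan_atLeast0 weighted_gram_def)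
    also have "\<dots> = (\<Sum>m<n. (if m = l then ?P $$ (i, m) else 0) +
        ?P $$ (i, m) * w m * (of_real (c q) * cnj (v q l)))"
      using l by (intro sum.cong) (auto simp: R_def algebra_simps)
    also have "\<dots> = ?P $$ (i, l) + v q i * (of_real (c q) * cnj (v q l))"
      using l by (simp add: sum.distrib sum_distrib_right w[OF i])
    also have "\<dots> = weighted_gram n (insert q K) c v $$ (i, l)"
      using i l assms(1,2) by (simp add: weighted_gram_def)
    finally show "weighted_gram n (insert q K) c v $$ (i, l) = (?P * R) $$ (i, l)" ..
  qed (simp_all add: weighted_gram_def R_def)
  hence "det (weighted_gram n (insert q K) c v) = det ?P * det R"
    using det_mult[of ?P n R] R by simp
  also have "det R = 1 + of_real (c q) * (\<Sum>l<n. cnj (v q l) * w l)"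
    unfolding R_def det_one_plus_rank_one by (simp add: sum_distrib_left mult_ac)
  finally have eq: "det (weighted_gram n (insert q K) c v) =
      det ?P + det ?P * (of_real (c q) * (\<Sum>l<n. cnj (v q l) * w l))"
    by (simp add: algebra_simps)
  have "0 \<le> (\<Sum>l<n. cnj (v q l) * w l)"
    by (rule weighted_gram_solution_nonneg[where K = K and c = c and v = v]) (use c w in auto)
  moreover have "0 \<le> complex_of_real (c q)"
    using c by (simp add: less_eq_complex_def)
  ultimately show ?thesis
    unfolding eq using pos by (simp add: mult_nonneg_nonneg less_imp_le)
qed

text \<open>The insertion step solves a linear system with the smaller matrix. Positivity of the first
  determinant passes to all later ones and keeps these systems solvable.\<close>

lemma det_weighted_gram_mono:
  assumes "finite L" and "K \<subseteq> L" and c: "\<And>k. k \<in> L \<Longrightarrow> 0 \<le> c k"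
    and pos: "0 < det (weighted_gram n K c v)"
  shows "det (weighted_gram n K c v) \<le> det (weighted_gram n L c v)"
proof -
  have "finite K" using assms(1,2) finite_subset by blast
  have "det (weighted_gram n K c v) \<le> det (weighted_gram n (D \<union> K) c v)"
    if "finite D" and "D \<subseteq> L - K" for D
    using that
  proof (induction D rule: finite_induct)
    case (insert q D)
    hence IH: "det (weighted_gram n K c v) \<le> det (weighted_gram n (D \<union> K) c v)" by simp
    also have "\<dots> \<le> det (weighted_gram n (insert q (D \<union> K)) c v)"
      using insert.hyps insert.prems \<open>finite K\<close> \<open>K \<subseteq> L\<close> c less_le_trans[OF pos IH]
      by (intro det_weighted_gram_insert) auto
    finally show ?case by simp
  qed simp
  from this[of "L - K"] show ?thesis
    using assms(1,2) by (simp add: Un_absorb2)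
qed

text \<open>With as many vectors as their dimension, the Gram matrix factors as \<open>A D A\<^sup>*\<close> with square
  factors.\<close>

lemma det_weighted_gram_reindex:
  assumes j: "bij_betw j {..<n} K"
  shows "det (weighted_gram n K c v) =
    of_real ((cmod (det (mat n n (\<lambda>(i, m). v (j m) i))))\<^sup>2 * (\<Prod>k\<in>K. c k))"
proof -
  interpret cnj: comm_ring_hom cnj by unfold_locales simp_all
  define A where "A = mat n n (\<lambda>(i, m). v (j m) i)"
  define D where "D = mat n n (\<lambda>(i, m). if i = m then complex_of_real (c (j i)) else 0)"
  define C where "C = transpose_mat (map_mat cnj A)"
  have car: "A \<in> carrier_mat n n" "D \<in> carrier_mat n n" "C \<in> carrier_mat n n"
      "map_mat cnj A \<in> carrier_mat n n"
    by (simp_all add: A_def D_def C_def)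
  have DC: "(D * C) $$ (m, l) = of_real (c (j m)) * cnj (v (j m) l)" if "m < n" "l < n" for m l
    using that by (simp add: D_def C_def A_def scalar_prod_def if_distrib[of "\<lambda>x. x * _"]
        cong: if_cong)
  have "weighted_gram n K c v = A * (D * C)"
  proof (rule eq_matI)
    fix i l assume "i < dim_row (A * (D * C))" and "l < dim_col (A * (D * C))"
    hence i: "i < n" and l: "l < n" using car by auto
    have "(A * (D * C)) $$ (i, l) = (\<Sum>m<n. A $$ (i, m) * (D * C) $$ (m, l))"
      using i l car by (simp add: scalar_prod_def lessThan_atLeast0)
    also have "\<dots> = (\<Sum>m<n. of_real (c (j m)) * (v (j m) i * cnj (v (j m) l)))"
      using i l by (intro sum.cong) (simp_all add: DC A_def)
    also have "\<dots> = (\<Sum>k\<in>K. of_real (c k) * (v k i * cnj (v k l)))"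
      by (rule sum.reindex_bij_betw[OF j])
    finally show "weighted_gram n K c v $$ (i, l) = (A * (D * C)) $$ (i, l)"
      using i l by (simp add: weighted_gram_def)
  qed (use car in \<open>simp_all add: weighted_gram_def\<close>)
  hence "det (weighted_gram n K c v) = det A * (det D * det C)"
    using car by (simp add: det_mult[of _ n])
  also have "det C = cnj (det A)"
    using det_transpose[OF car(4)] by (simp add: C_def)
  also have "det D = (\<Prod>m<n. of_real (c (j m)))"
    by (subst det_upper_triangular[OF _ car(2)])
       (auto simp: D_def prod_list_diag_prod lessThan_atLeast0)
  also have "\<dots> = (\<Prod>k\<in>K. of_real (c k))"
    by (rule prod.reindex_bij_betw[OF j])
  finally show ?thesis
    by (simp add: A_def[symmetric] complex_norm_square mult_ac del: of_real_power)
qed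

section \<open>The Taylor coefficients\<close>

text \<open>Since \<open>log a\<^sub>k / k\<close> eventually lies below \<open>-log (2r)\<close>, eventually
  \<open>a\<^sub>k \<le> (2r)\<^sup>-\<^sup>k\<close>. The factor 2 leaves a geometric series for comparison.\<close>

lemma eventually_coeff_le_half_power:
  assumes nonneg: "\<And>k. a k \<ge> 0"
    and lim: "((\<lambda>k. log0 (a k) / ereal (real k)) \<longlongrightarrow> -\<infinity>) sequentially"
    and r: "r \<ge> 1"
  shows "eventually (\<lambda>k. a k * r ^ k \<le> (1/2) ^ k) sequentially"
proof -
  have "eventually (\<lambda>k. log0 (a k) / ereal (real k) < ereal (- ln (2 * r))) sequentially"
    using lim by (rule order_tendstoD) simp
  with eventually_gt_at_top[of 0] show ?thesis
  proof eventually_elim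
    case (elim k)
    show ?case
    proof (cases "a k = 0")
      case False
      hence pos: "a k > 0" using nonneg[of k] by simp
      have "ln (a k) / real k < - ln (2 * r)"
        using elim False by (simp add: log0_def)
      hence "ln (a k) < - real k * ln (2 * r)"
        using elim(1) by (simp add: field_simps)
      hence "ln (a k) < ln ((1 / (2 * r)) ^ k)"
        using r by (simp add: ln_realpow ln_div)
      hence "a k < (1 / (2 * r)) ^ k" using pos r by (subst (asm) ln_less_cancel_iff) auto
      hence "a k * r ^ k \<le> (1 / (2 * r)) ^ k * r ^ k"
        using r by (intro mult_right_mono) auto
      also have "\<dots> = (1/2) ^ k" using r by (simp add: power_mult_distrib[symmetric])
      finally show ?thesis .
    qed simp
  qed
qed

lemma finite_N_set:
  assumes "eventually (\<lambda>k. a k * r ^ k \<le> (1/2) ^ k) sequentially"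
  shows "finite (N_set a r)"
proof -
  have "eventually (\<lambda>k. a k * r ^ k < 1) sequentially"
    using assms eventually_gt_at_top[of 0]
  proof eventually_elim
    case (elim k)
    have "(1/2 :: real) ^ k < 1" using elim(2) by (simp add: power_less_one_iff)
    with elim(1) show ?case by linarith
  qed
  then obtain M where "\<And>k. k \<ge> M \<Longrightarrow> a k * r ^ k < 1"
    by (auto simp: eventually_sequentially)
  hence "N_set a r \<subseteq> {..<M}"
    by (force simp: N_set_def not_less[symmetric])
  thus ?thesis by (rule finite_subset) simp
qed

lemma log_plus_eq:
  assumes "x \<ge> 0"
  shows "log_plus x = (if x \<ge> 1 then ln x else 0)"
proof (cases "x = 0")
  case False
  hence "0 \<le> ln x \<longleftrightarrow> 1 \<le> x" using assms by (intro ln_ge_zero_iff) simp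
  with False show ?thesis by (auto simp: log_plus_def log0_def max_def zero_ereal_def)
qed (simp add: log_plus_def log0_def)

lemma exp_S_fun:
  assumes "\<And>k. a k \<ge> 0" and "r \<ge> 0" and fin: "finite (N_set a r)"
  shows "exp (S_fun a r) = (\<Prod>k\<in>N_set a r. (a k * r ^ k)\<^sup>2)"
proof -
  have outside: "log_plus (a k * r ^ k) = 0" if "k \<notin> N_set a r" for k
    using that assms(1,2) by (simp add: log_plus_eq N_set_def)
  have inside: "exp (2 * log_plus (a k * r ^ k)) = (a k * r ^ k)\<^sup>2" if "k \<in> N_set a r" for k
  proof -
    have "a k * r ^ k \<ge> 1" using that by (simp add: N_set_def)
    thus ?thesis by (simp add: log_plus_eq exp_double)
  qed
  have "S_fun a r = (\<Sum>k\<in>N_set a r. 2 * log_plus (a k * r ^ k))"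
    unfolding S_fun_def by (subst suminf_finite[OF fin]) (auto simp: outside sum_distrib_left)
  thus ?thesis by (simp add: exp_sum[OF fin] inside)
qed

text \<open>The entries converge absolutely because \<open>\<bar>z\<^sub>i z\<^sub>l\<bar>\<^sup>k = r\<^sup>2\<^sup>k\<close> turns the \<open>k\<close>-th term into
  \<open>(a\<^sub>k r\<^sup>k)\<^sup>2\<close>.\<close>

lemma Sigma_entry_summable:
  fixes x y :: complex
  assumes nonneg: "\<And>k. a k \<ge> 0" "r \<ge> 0"
    and decay: "eventually (\<lambda>k. a k * r ^ k \<le> (1/2) ^ k) sequentially"
    and "cmod x = r" "cmod y = r"
  shows "summable (\<lambda>k. complex_of_real ((a k)\<^sup>2) * (x * cnj y) ^ k)"
proof (rule summable_comparison_test_ev)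
  show "eventually (\<lambda>k. norm (complex_of_real ((a k)\<^sup>2) * (x * cnj y) ^ k) \<le> (1/4) ^ k) sequentially"
    using decay
  proof eventually_elim
    case (elim k)
    have "norm (complex_of_real ((a k)\<^sup>2) * (x * cnj y) ^ k) = (a k * r ^ k)\<^sup>2"
      using assms(4,5) by (simp add: norm_mult norm_power power_mult_distrib power2_eq_square)
    also have "\<dots> \<le> ((1/2) ^ k)\<^sup>2"
      using elim nonneg by (intro power_mono) auto
    also have "\<dots> = (1/4) ^ k"
      by (simp add: power2_eq_square power_mult_distrib[symmetric])
    finally show ?case .
  qed
qed simp

section \<open>The lower bound\<close>

theorem corollary14:
  fixes a :: "nat \<Rightarrow> real" and r :: real and n :: nat
    and j :: "nat \<Rightarrow> nat" and z :: "nat \<Rightarrow> complex"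
  assumes "\<And>k. a k \<ge> 0" and "a 0 = 1"
    and "((\<lambda>k. log0 (a k) / ereal (real k)) \<longlongrightarrow> -\<infinity>) sequentially"
    and "r \<ge> 1"
    and "n = card (N_set a r)"
    and "bij_betw j {..<n} (N_set a r)" and "j 0 = 0"
    and "\<And>i. i < n \<Longrightarrow> cmod (z i) = r"
    and "cmod (det (gen_vandermonde n z j)) \<ge> r ^ (\<Sum>k=1..<n. j k)"
  shows "det (Sigma_mat a n z) \<in> \<real> \<and> Re (det (Sigma_mat a n z)) > 0 \<and>
         ln (Re (det (Sigma_mat a n z))) \<ge> S_fun a r"
proof -
  let ?N = "N_set a r"
  let ?G = "\<lambda>K. weighted_gram n K (\<lambda>k. (a k)\<^sup>2) (\<lambda>k i. z i ^ k)"
  have decay: "eventually (\<lambda>k. a k * r ^ k \<le> (1/2) ^ k) sequentially"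
    by (rule eventually_coeff_le_half_power[OF assms(1,3,4)])
  have fin: "finite ?N" by (rule finite_N_set[OF decay])
  have r_power: "r ^ (\<Sum>k=1..<n. j k) = (\<Prod>k\<in>?N. r ^ k)"
  proof -
    have "(\<Sum>k=1..<n. j k) = (\<Sum>m<n. j m)"
      by (rule sum.mono_neutral_left) (auto simp: assms(7) not_less_eq_eq)
    also have "\<dots> = (\<Sum>k\<in>?N. k)"
      by (rule sum.reindex_bij_betw[OF assms(6)])
    finally show ?thesis by (simp only: power_sum)
  qed
  have "exp (S_fun a r) = (r ^ (\<Sum>k=1..<n. j k))\<^sup>2 * (\<Prod>k\<in>?N. (a k)\<^sup>2)"
    using assms(1,4) fin
    by (simp add: exp_S_fun r_power prod_power_distrib power_mult_distrib prod.distrib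
        mult.commute del: One_nat_def)
  also have "\<dots> \<le> (cmod (det (gen_vandermonde n z j)))\<^sup>2 * (\<Prod>k\<in>?N. (a k)\<^sup>2)"
    using assms(4,9) by (intro mult_right_mono power_mono prod_nonneg) auto
  finally have base: "complex_of_real (exp (S_fun a r)) \<le> det (?G ?N)"
    unfolding det_weighted_gram_reindex[OF assms(6)] gen_vandermonde_def
    by (simp add: less_eq_complex_def del: of_real_mult of_real_power)
  have pos: "0 < det (?G ?N)"
    by (rule less_le_trans[OF _ base]) (simp add: less_complex_def)
  obtain M where M: "?N \<subseteq> {..<M}"
    using finite_nat_iff_bounded fin by blast
  have partial: "complex_of_real (exp (S_fun a r)) \<le> det (?G {..<m})" if "m \<ge> M" for m
  proof -
    have "?N \<subseteq> {..<m}" using M that by auto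
    hence "det (?G ?N) \<le> det (?G {..<m})"
      using pos by (intro det_weighted_gram_mono) auto
    with base show ?thesis by (rule order_trans)
  qed
  have lim: "(\<lambda>m. det (?G {..<m})) \<longlonglongrightarrow> det (Sigma_mat a n z)"
  proof (rule tendsto_det)
    fix i l assume il: "i < n" "l < n"
    have "(\<lambda>m. \<Sum>k<m. complex_of_real ((a k)\<^sup>2) * (z i * cnj (z l)) ^ k)
        \<longlonglongrightarrow> (\<Sum>k. complex_of_real ((a k)\<^sup>2) * (z i * cnj (z l)) ^ k)"
      using il assms(1,4,8) decay
      by (intro summable_LIMSEQ Sigma_entry_summable[where r = r]) auto
    thus "(\<lambda>m. ?G {..<m} $$ (i, l)) \<longlonglongrightarrow> Sigma_mat a n z $$ (i, l)"
      using il by (simp add: weighted_gram_def Sigma_mat_def power_mult_distrib)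
  qed (simp_all add: Sigma_mat_def)
  have "(\<lambda>m. Im (det (?G {..<m}))) \<longlonglongrightarrow> 0"
    by (rule tendsto_eventually, rule eventually_sequentiallyI[of M])
       (use partial in \<open>simp add: less_eq_complex_def\<close>)
  with tendsto_Im[OF lim] have "Im (det (Sigma_mat a n z)) = 0"
    by (rule LIMSEQ_unique)
  moreover have "exp (S_fun a r) \<le> Re (det (Sigma_mat a n z))"
    by (rule LIMSEQ_le_const[OF tendsto_Re[OF lim]])
       (use partial in \<open>auto simp: less_eq_complex_def\<close>)
  moreover from this have "Re (det (Sigma_mat a n z)) > 0"
    using less_le_trans[OF exp_gt_zero] by blast
  ultimately show ?thesis
    by (simp add: complex_is_Real_iff ln_ge_iff)
qed

end
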